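(* Let $n\ge 2$, let $(X,\|\cdot\|)$ be a normed linear space over $\mathbb{K}$ ($\mathbb{K}=\mathbb{R}$ or $\mathbb{C}$), $\mathbf{a}=(a_1,\dots,a_n)\in\mathbb{K}^n$, $\mathbf{p}=(p_1,\dots,p_n)\in\mathbb{R}^n$ and $\mathbf{x}=(x_1,\dots,x_n)\in X^n$. Put $$D_i:=\det\begin{pmatrix}P_i & P_n\\ A_i(\mathbf{p}) & A_n(\mathbf{p})\end{pmatrix}=P_iA_n(\mathbf{p})-P_nA_i(\mathbf{p}),\qquad i\in\{1,\dots,n-1\}.$$ Then the following three inequalities hold: (i) $\displaystyle \|T_n(\mathbf{p};\mathbf{a},\mathbf{x})\|\le \max_{1\le i\le n-1}|D_i|\cdot\sum_{j=1}^{n-1}\|\Delta x_j\|$; (ii) for all real $p>1$ and $q$ with $\frac1p+\frac1q=1$, $\displaystyle \|T_n(\mathbf{p};\mathbf{a},\mathbf{x})\|\le \Big(\sum_{i=1}^{n-1}|D_i|^q\Big)^{1/q}\Big(\sum_{j=1}^{n-1}\|\Delta x_j\|^p\Big)^{1/p}$; (iii) $\displaystyle \|T_n(\mathbf{p};\mathbf{a},\mathbf{x})\|\le \sum_{i=1}^{n-1}|D_i|\cdot\max_{1\le j\le n-1}\|\Delta x_j\|$. Moreover, each of these inequalities is sharp in the sense that the constant $1$ multiplying its right-hand side cannot be replaced by a smaller constant.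
   Context: The Čebyšev functional is $T_n(\mathbf{p};\mathbf{a},\mathbf{x}):=P_n\sum_{i=1}^n p_ia_ix_i-\left(\sum_{i=1}^n p_ia_i\right)\cdot\sum_{i=1}^n p_ix_i$. Notation: $P_i:=\sum_{k=1}^i p_k$ and $A_i(\mathbf{p}):=\sum_{k=1}^i p_ka_k$ for $1\le i\le n$; $\Delta x_i:=x_{i+1}-x_i$ for $1\le i\le n-1$. The bold $\mathbf{p}$ is the weight tuple; the exponent $p$ is unrelated to it. Sharpness of an inequality $\|T_n\|\le R$ (with $p,q$ fixed, in the case of (ii)) means: if $C>0$ is a constant such that $\|T_n\|\le C\,R$ for all $n\ge2$, all normed spaces $X$ and all admissible $\mathbf{p},\mathbf{a},\mathbf{x}$, then $C\ge1$. *)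

theory Defs
  imports
    "HOL-Analysis.Determinants"
    "HOL-Library.Equipollence"
    "HOL-Algebra.Module"
    "HOL-Algebra.Algebraic_Closure_Type"
begin

text \<open>
  The scalar field is a type of class \<^class>\<open>real_normed_field\<close>. By the Gelfand--Mazur theorem
  the only such fields, up to isometric isomorphism, are the real and the complex numbers.

  A normed space has an explicit carrier set, so that one formula can quantify over all normed
  spaces whose vectors are drawn from a given type; this is needed for sharpness. The inherited
  locale is the one for modules in HOL-Algebra, over the field of scalars viewed as a ring
  structure. The multiplication and unit fields of the record are irrelevant.
\<close>

locale normed_space =
  Module.module "ring_of_type_algebra :: 'k::real_normed_field ring" V
  for V :: "('k::real_normed_field, 'v) module" (structure) +
  fixes nrm :: "'v \<Rightarrow> real"
  assumes nrm_nonneg: "x \<in> carrier V \<Longrightarrow> 0 \<le> nrm x"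
    and nrm_eq_0_iff: "x \<in> carrier V \<Longrightarrow> nrm x = 0 \<longleftrightarrow> x = \<zero>"
    and nrm_smult: "x \<in> carrier V \<Longrightarrow> nrm (c \<odot> x) = norm c * nrm x"
    and nrm_triangle: "x \<in> carrier V \<Longrightarrow> y \<in> carrier V \<Longrightarrow> nrm (x \<oplus> y) \<le> nrm x + nrm y"

text \<open>All tuples are functions on the naturals of which only the entries at 1, ..., n matter.\<close>

definition psum :: "(nat \<Rightarrow> real) \<Rightarrow> nat \<Rightarrow> real"
  where "psum p i = (\<Sum>k = 1..i. p k)"

definition wsum :: "(nat \<Rightarrow> real) \<Rightarrow> (nat \<Rightarrow> 'k::real_normed_field) \<Rightarrow> nat \<Rightarrow> 'k"
  where "wsum p a i = (\<Sum>k = 1..i. of_real (p k) * a k)"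

definition chebyshev ::
    "('k::real_normed_field, 'v) module \<Rightarrow> nat \<Rightarrow> (nat \<Rightarrow> real) \<Rightarrow> (nat \<Rightarrow> 'k) \<Rightarrow> (nat \<Rightarrow> 'v) \<Rightarrow> 'v"
  where "chebyshev V n p a x =
    of_real (psum p n) \<odot>\<^bsub>V\<^esub> (\<Oplus>\<^bsub>V\<^esub>i\<in>{1..n}. (of_real (p i) * a i) \<odot>\<^bsub>V\<^esub> x i)
      \<ominus>\<^bsub>V\<^esub> wsum p a n \<odot>\<^bsub>V\<^esub> (\<Oplus>\<^bsub>V\<^esub>i\<in>{1..n}. of_real (p i) \<odot>\<^bsub>V\<^esub> x i)"

definition fdiff :: "('k, 'v) module \<Rightarrow> (nat \<Rightarrow> 'v) \<Rightarrow> nat \<Rightarrow> 'v"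
  where "fdiff V x i = x (i + 1) \<ominus>\<^bsub>V\<^esub> x i"

definition Ddet :: "nat \<Rightarrow> (nat \<Rightarrow> real) \<Rightarrow> (nat \<Rightarrow> 'k::real_normed_field) \<Rightarrow> nat \<Rightarrow> 'k"
  where "Ddet n p a i =
    det (vector [vector [of_real (psum p i), of_real (psum p n)],
                 vector [wsum p a i, wsum p a n]] :: 'k^2^2)"

lemma Ddet_eq: "Ddet n p a i = of_real (psum p i) * wsum p a n - of_real (psum p n) * wsum p a i"
  by (simp add: Ddet_def det_2 vector_2)

definition bound_max_sum ::
    "('k::real_normed_field, 'v) module \<Rightarrow> ('v \<Rightarrow> real) \<Rightarrow> nat \<Rightarrow> (nat \<Rightarrow> real) \<Rightarrow> (nat \<Rightarrow> 'k) \<Rightarrow>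
      (nat \<Rightarrow> 'v) \<Rightarrow> real"
  where "bound_max_sum V nrm n p a x =
    (MAX i\<in>{1..n-1}. norm (Ddet n p a i)) * (\<Sum>j = 1..n-1. nrm (fdiff V x j))"

definition bound_holder ::
    "real \<Rightarrow> real \<Rightarrow>
      ('k::real_normed_field, 'v) module \<Rightarrow> ('v \<Rightarrow> real) \<Rightarrow> nat \<Rightarrow> (nat \<Rightarrow> real) \<Rightarrow> (nat \<Rightarrow> 'k) \<Rightarrow>
      (nat \<Rightarrow> 'v) \<Rightarrow> real"
  where "bound_holder r s V nrm n p a x =
    (\<Sum>i = 1..n-1. norm (Ddet n p a i) powr s) powr (1 / s)
      * (\<Sum>j = 1..n-1. nrm (fdiff V x j) powr r) powr (1 / r)"

definition bound_sum_max ::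
    "('k::real_normed_field, 'v) module \<Rightarrow> ('v \<Rightarrow> real) \<Rightarrow> nat \<Rightarrow> (nat \<Rightarrow> real) \<Rightarrow> (nat \<Rightarrow> 'k) \<Rightarrow>
      (nat \<Rightarrow> 'v) \<Rightarrow> real"
  where "bound_sum_max V nrm n p a x =
    (\<Sum>i = 1..n-1. norm (Ddet n p a i)) * (MAX j\<in>{1..n-1}. nrm (fdiff V x j))"

text \<open>
  Sharpness of the bound \<open>R\<close> for the norm of the Chebyshev functional, where the normed space
  ranges over all those over \<open>'k\<close> with vectors in the type \<open>'v\<close>. If \<open>'v\<close> has fewer elements than
  \<open>'k\<close>, then only zero spaces are among them, and no bound is sharp.
\<close>

definition sharp_bound ::
    "(('k::real_normed_field, 'v) module \<Rightarrow> ('v \<Rightarrow> real) \<Rightarrow> nat \<Rightarrow> (nat \<Rightarrow> real) \<Rightarrow> (nat \<Rightarrow> 'k) \<Rightarrow>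
      (nat \<Rightarrow> 'v) \<Rightarrow> real) \<Rightarrow> bool"
  where "sharp_bound R \<longleftrightarrow>
    (\<forall>C>0.
      (\<forall>n\<ge>2. \<forall>V nrm p a x. normed_space V nrm \<longrightarrow> x \<in> {1..n} \<rightarrow> carrier V \<longrightarrow>
        nrm (chebyshev V n p a x) \<le> C * R V nrm n p a x)
      \<longrightarrow> C \<ge> 1)"

end

theory Submission
  imports Defs "HOL-Analysis.Convex"
begin

text \<open>
  Everything rests on one identity. The determinants vanish at both ends, \<open>D 0 = D n = 0\<close>, and
  \<open>D (i - 1) - D i = P\<^sub>n p\<^sub>i a\<^sub>i - A\<^sub>n p\<^sub>i\<close> is exactly the coefficient of \<open>x\<^sub>i\<close> in the Chebyshev
  functional. Summation by parts therefore turns the functional into a sum of differences with no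
  boundary terms, \<open>T = \<Sum> D\<^sub>i \<Delta>x\<^sub>i\<close> over \<open>1 \<le> i \<le> n - 1\<close> (lemma \<open>chebyshev_eq_sum_fdiff\<close>). The
  triangle inequality bounds its norm by \<open>\<Sum> \<bar>D\<^sub>i\<bar> \<parallel>\<Delta>x\<^sub>i\<parallel>\<close>, and the three estimates are the
  Hoelder inequality for this sum with the exponent pairs \<open>(\<infinity>, 1)\<close>, \<open>(s, r)\<close> and \<open>(1, \<infinity>)\<close>.

  For \<open>n = 2\<close> the sum has the single term \<open>D\<^sub>1 \<Delta>x\<^sub>1\<close>, whose norm is \<open>\<bar>D\<^sub>1\<bar> \<parallel>\<Delta>x\<^sub>1\<parallel>\<close>, so all three
  estimates are equalities. One example with a nonzero value therefore shows that no constant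
  below 1 will do. It is found in the scalar field itself, regarded as a one-dimensional normed
  space and copied into the vector type along an injection.
\<close>

section \<open>Summation by parts in a normed space\<close>

lemma (in normed_space) smult_closed_UNIV: "x \<in> carrier V \<Longrightarrow> c \<odot> x \<in> carrier V"
  using smult_closed[of c x] by (simp add: ring_of_type_algebra_def)

lemma (in normed_space) smult_distribs:
  assumes "x \<in> carrier V"
  shows smult_add_left: "(c + d) \<odot> x = c \<odot> x \<oplus> d \<odot> x"
    and smult_mult: "(c * d) \<odot> x = c \<odot> (d \<odot> x)"
    and smult_zero_left: "0 \<odot> x = \<zero>"
  using assms smult_l_distr[of c d x] smult_assoc1[of c d x] smult_l_null[of x]
  by (simp_all add: ring_of_type_algebra_def)

lemma (in normed_space) smult_uminus_left:
  assumes x: "x \<in> carrier V"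
  shows "(- c) \<odot> x = \<ominus> (c \<odot> x)"
proof -
  have "(- c) \<odot> x \<oplus> c \<odot> x = \<zero>"
    using smult_add_left[OF x, of "- c" c] smult_zero_left[OF x] by simp
  then show ?thesis
    using x by (metis M.minus_equality smult_closed_UNIV)
qed

lemma (in normed_space) smult_diff_left:
  "x \<in> carrier V \<Longrightarrow> (c - d) \<odot> x = c \<odot> x \<ominus> d \<odot> x"
  using smult_add_left[of x c "- d"] smult_uminus_left[of x d] by (simp add: M.minus_eq)

lemma (in normed_space) smult_diff_right:
  assumes "x \<in> carrier V" "y \<in> carrier V"
  shows "c \<odot> (x \<ominus> y) = c \<odot> x \<ominus> c \<odot> y"
  using assms smult_r_distr[of c x "\<ominus> y"] smult_r_minus[of c y]
  by (simp add: M.minus_eq ring_of_type_algebra_def)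

lemma (in normed_space) fdiff_closed:
  "x \<in> {1..n} \<rightarrow> carrier V \<Longrightarrow> i \<in> {1..n-1} \<Longrightarrow> fdiff V x i \<in> carrier V"
  unfolding fdiff_def by (intro M.minus_closed) (auto simp: Pi_iff)

lemma (in normed_space) finsum_atLeast1_Suc:
  assumes "f \<in> {1..Suc m} \<rightarrow> carrier V"
  shows "(\<Oplus>i\<in>{1..Suc m}. f i) = (\<Oplus>i\<in>{1..m}. f i) \<oplus> f (Suc m)"
proof -
  have "{1..Suc m} = insert (Suc m) {1..m}" by auto
  then have "(\<Oplus>i\<in>{1..Suc m}. f i) = f (Suc m) \<oplus> (\<Oplus>i\<in>{1..m}. f i)"
    using assms by (simp add: M.finsum_insert Pi_iff)
  also have "\<dots> = (\<Oplus>i\<in>{1..m}. f i) \<oplus> f (Suc m)"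
    using assms by (intro M.a_comm M.finsum_closed) (auto simp: Pi_iff)
  finally show ?thesis .
qed

text \<open>
  The right boundary term is kept here: in the application \<open>d\<close> also vanishes at the right end of
  the full range, but the induction passes through shorter ranges, where it does not.
\<close>

lemma (in normed_space) summation_by_parts:
  assumes "d 0 = 0" and "x \<in> {1..Suc m} \<rightarrow> carrier V"
  shows "(\<Oplus>i\<in>{1..Suc m}. (d (i - 1) - d i) \<odot> x i)
    = (\<Oplus>i\<in>{1..m}. d i \<odot> fdiff V x i) \<ominus> d (Suc m) \<odot> x (Suc m)"
  using assms(2)
proof (induction m)
  case 0
  then have x1: "x 1 \<in> carrier V" by auto
  then show ?case
    using assms(1)
    by (simp add: M.minus_eq smult_uminus_left smult_closed_UNIV)
next
  case (Suc m)
  let ?S = "\<Oplus>i\<in>{1..m}. d i \<odot> fdiff V x i"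
  let ?y = "x (Suc m)" and ?z = "x (Suc (Suc m))"
  have xs: "x i \<in> carrier V" if "i \<in> {1..Suc (Suc m)}" for i
    using Suc.prems that by auto
  have yz: "?y \<in> carrier V" "?z \<in> carrier V" by (simp_all add: xs)
  have S: "?S \<in> carrier V"
    by (intro M.finsum_closed funcsetI smult_closed_UNIV fdiff_closed[of x "Suc m"])
       (auto intro: xs)
  note closed = S yz smult_closed_UNIV
  have "(\<Oplus>i\<in>{1..Suc (Suc m)}. (d (i - 1) - d i) \<odot> x i)
      = (\<Oplus>i\<in>{1..Suc m}. (d (i - 1) - d i) \<odot> x i) \<oplus> (d (Suc m) - d (Suc (Suc m))) \<odot> ?z"
    by (subst finsum_atLeast1_Suc) (auto intro!: smult_closed_UNIV xs)
  also have "\<dots> = (?S \<ominus> d (Suc m) \<odot> ?y) \<oplus> (d (Suc m) \<odot> ?z \<ominus> d (Suc (Suc m)) \<odot> ?z)"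
    using Suc.IH xs by (simp add: smult_diff_left yz Pi_iff)
  also have "\<dots> = (?S \<oplus> (d (Suc m) \<odot> ?z \<ominus> d (Suc m) \<odot> ?y)) \<ominus> d (Suc (Suc m)) \<odot> ?z"
    using closed by (simp add: M.minus_eq M.a_ac)
  also have "d (Suc m) \<odot> ?z \<ominus> d (Suc m) \<odot> ?y = d (Suc m) \<odot> fdiff V x (Suc m)"
    by (simp add: fdiff_def smult_diff_right yz)
  also have "?S \<oplus> d (Suc m) \<odot> fdiff V x (Suc m) = (\<Oplus>i\<in>{1..Suc m}. d i \<odot> fdiff V x i)"
    by (rule finsum_atLeast1_Suc[symmetric])
       (intro funcsetI smult_closed_UNIV fdiff_closed[of x "Suc (Suc m)"]; use xs in auto)
  finally show ?case .
qed

section \<open>The Chebyshev functional as a sum of differences\<close>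

lemma Ddet_ends: "Ddet n p a 0 = 0" "Ddet n p a n = 0"
  by (simp_all add: Ddet_eq psum_def wsum_def mult.commute)

lemma Ddet_diff:
  assumes "i \<ge> 1"
  shows "Ddet n p a (i - 1) - Ddet n p a i
    = of_real (psum p n) * (of_real (p i) * a i) - wsum p a n * of_real (p i)"
proof -
  obtain j where "i = Suc j" using assms by (cases i) auto
  then show ?thesis
    by (simp add: Ddet_eq psum_def wsum_def algebra_simps)
qed

text \<open>
  Collecting the coefficient of each \<open>x i\<close> gives a sum to which summation by parts applies with
  \<open>d = Ddet n p a\<close>; the boundary term left over disappears because \<open>Ddet n p a n = 0\<close>.
\<close>

lemma (in normed_space) chebyshev_eq_sum_fdiff:
  assumes "n \<ge> 1" and x: "x \<in> {1..n} \<rightarrow> carrier V"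
  shows "chebyshev V n p a x = (\<Oplus>i\<in>{1..n-1}. Ddet n p a i \<odot> fdiff V x i)"
proof -
  let ?P = "of_real (psum p n)" and ?A = "wsum p a n"
  let ?u = "\<lambda>i. (of_real (p i) * a i) \<odot> x i" and ?v = "\<lambda>i. of_real (p i) \<odot> x i"
  obtain m where n: "n = Suc m" using assms(1) by (cases n) auto
  have xs: "x i \<in> carrier V" if "i \<in> {1..n}" for i using x that by auto
  have u: "?u \<in> {1..n} \<rightarrow> carrier V" and v: "?v \<in> {1..n} \<rightarrow> carrier V"
    using xs by (auto intro!: smult_closed_UNIV)
  have scale: "c \<odot> (\<Oplus>i\<in>{1..n}. f i) = (\<Oplus>i\<in>{1..n}. c \<odot> f i)"
    if "f \<in> {1..n} \<rightarrow> carrier V" for c f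
    using that by (intro finsum_smult_ldistr) (auto simp: ring_of_type_algebra_def)
  have "chebyshev V n p a x
      = ?P \<odot> (\<Oplus>i\<in>{1..n}. ?u i) \<oplus> (- ?A) \<odot> (\<Oplus>i\<in>{1..n}. ?v i)"
    using v by (simp add: chebyshev_def M.minus_eq smult_uminus_left M.finsum_closed)
  also have "\<dots> = (\<Oplus>i\<in>{1..n}. ?P \<odot> ?u i) \<oplus> (\<Oplus>i\<in>{1..n}. (- ?A) \<odot> ?v i)"
    by (simp only: scale u v)
  also have "\<dots> = (\<Oplus>i\<in>{1..n}. ?P \<odot> ?u i \<oplus> (- ?A) \<odot> ?v i)"
    by (intro M.finsum_addf[symmetric] funcsetI smult_closed_UNIV xs)
  also have "\<dots> = (\<Oplus>i\<in>{1..n}. (Ddet n p a (i - 1) - Ddet n p a i) \<odot> x i)"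
  proof (rule M.finsum_cong')
    fix i assume i: "i \<in> {1..n}"
    then have "i \<ge> 1" by simp
    have "(Ddet n p a (i - 1) - Ddet n p a i) \<odot> x i
        = (?P * (of_real (p i) * a i) + (- ?A) * of_real (p i)) \<odot> x i"
      by (simp only: Ddet_diff[OF \<open>i \<ge> 1\<close>]) simp
    also have "\<dots> = ?P \<odot> ?u i \<oplus> (- ?A) \<odot> ?v i"
      by (simp only: smult_add_left smult_mult xs[OF i])
    finally show "?P \<odot> ?u i \<oplus> (- ?A) \<odot> ?v i = (Ddet n p a (i - 1) - Ddet n p a i) \<odot> x i" ..
  qed (use xs in \<open>auto intro!: smult_closed_UNIV\<close>)
  also have "\<dots> = (\<Oplus>i\<in>{1..n-1}. Ddet n p a i \<odot> fdiff V x i) \<ominus> Ddet n p a n \<odot> x n"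
    using summation_by_parts[of "Ddet n p a" x m] x by (simp add: Ddet_ends n)
  also have "\<dots> = (\<Oplus>i\<in>{1..n-1}. Ddet n p a i \<odot> fdiff V x i)"
  proof -
    have "(\<Oplus>i\<in>{1..n-1}. Ddet n p a i \<odot> fdiff V x i) \<in> carrier V"
      by (intro M.finsum_closed funcsetI smult_closed_UNIV fdiff_closed[OF x])
    moreover have "x n \<in> carrier V" using xs n by simp
    ultimately show ?thesis
      by (simp add: Ddet_ends smult_zero_left M.minus_eq)
  qed
  finally show ?thesis .
qed

section \<open>The three estimates\<close>

lemma (in normed_space) nrm_finsum_le:
  assumes "finite I" and "f \<in> I \<rightarrow> carrier V"
  shows "nrm (\<Oplus>i\<in>I. f i) \<le> (\<Sum>i\<in>I. nrm (f i))"
  using assms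
proof (induction I rule: finite_induct)
  case empty
  then show ?case using nrm_eq_0_iff[OF M.zero_closed] by simp
next
  case (insert i I)
  then have f: "f i \<in> carrier V" "f \<in> I \<rightarrow> carrier V" by auto
  have "nrm (\<Oplus>j\<in>insert i I. f j) \<le> nrm (f i) + nrm (\<Oplus>j\<in>I. f j)"
    using insert.hyps f nrm_triangle[of "f i" "\<Oplus>j\<in>I. f j"]
    by (simp add: M.finsum_insert M.finsum_closed)
  then show ?case using insert.IH[OF f(2)] insert.hyps by simp
qed

lemma (in normed_space) nrm_chebyshev_le:
  assumes "n \<ge> 1" and x: "x \<in> {1..n} \<rightarrow> carrier V"
  shows "nrm (chebyshev V n p a x)
    \<le> (\<Sum>i\<in>{1..n-1}. norm (Ddet n p a i) * nrm (fdiff V x i))"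
proof -
  have "nrm (chebyshev V n p a x) \<le> (\<Sum>i\<in>{1..n-1}. nrm (Ddet n p a i \<odot> fdiff V x i))"
    unfolding chebyshev_eq_sum_fdiff[OF assms]
    by (intro nrm_finsum_le funcsetI smult_closed_UNIV fdiff_closed[OF x]) simp
  also have "\<dots> = (\<Sum>i\<in>{1..n-1}. norm (Ddet n p a i) * nrm (fdiff V x i))"
    by (intro sum.cong refl nrm_smult fdiff_closed[OF x])
  finally show ?thesis .
qed

lemma sum_mult_le_Max_mult_sum:
  fixes f g :: "'i \<Rightarrow> real"
  assumes "finite I" and "\<And>i. i \<in> I \<Longrightarrow> 0 \<le> g i"
  shows "(\<Sum>i\<in>I. f i * g i) \<le> (MAX i\<in>I. f i) * (\<Sum>i\<in>I. g i)"
  unfolding sum_distrib_left using assms by (intro sum_mono mult_right_mono Max_ge) auto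

text \<open>
  If one family vanishes, both sides are 0. Otherwise scale both to norm 1 in their respective
  exponents; Young's inequality applied termwise then bounds the sum by \<open>1 / s + 1 / r = 1\<close>.
\<close>

lemma Hoelder_inequality_sum:
  fixes f g :: "'i \<Rightarrow> real"
  assumes fin: "finite I" and f: "\<And>i. i \<in> I \<Longrightarrow> 0 \<le> f i" and g: "\<And>i. i \<in> I \<Longrightarrow> 0 \<le> g i"
    and r: "r > 1" and rs: "1 / r + 1 / s = 1"
  shows "(\<Sum>i\<in>I. f i * g i)
    \<le> (\<Sum>i\<in>I. f i powr s) powr (1 / s) * (\<Sum>i\<in>I. g i powr r) powr (1 / r)"
proof -
  define F where "F = (\<Sum>i\<in>I. f i powr s)"
  define G where "G = (\<Sum>i\<in>I. g i powr r)"
  have "1 / s = 1 - 1 / r" using rs by simp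
  also have "\<dots> > 0" using r by simp
  finally have s0: "s > 0" by simp
  have "1 / s < 1" using rs r by (smt (verit) divide_pos_pos)
  then have s: "s > 1" using s0 by simp
  show ?thesis
  proof (cases "F = 0 \<or> G = 0")
    case True
    then have "(\<forall>i\<in>I. f i powr s = 0) \<or> (\<forall>i\<in>I. g i powr r = 0)"
      unfolding F_def G_def using fin by (simp add: sum_nonneg_eq_0_iff)
    then have "(\<Sum>i\<in>I. f i * g i) = 0" by (auto intro!: sum.neutral)
    then show ?thesis by simp
  next
    case False
    have "F \<ge> 0" "G \<ge> 0" unfolding F_def G_def by (auto intro!: sum_nonneg)
    with False have pos: "F > 0" "G > 0" by auto
    define u where "u = F powr (1 / s)"
    define v where "v = G powr (1 / r)"
    have uv: "u > 0" "v > 0" using pos by (simp_all add: u_def v_def)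
    have us: "u powr s = F" and vr: "v powr r = G"
      using pos s r by (simp_all add: u_def v_def powr_powr)
    have "(\<Sum>i\<in>I. (f i / u) * (g i / v))
        \<le> (\<Sum>i\<in>I. (f i / u) powr s / s + (g i / v) powr r / r)"
      using f g uv s r rs by (intro sum_mono Youngs_inequality) auto
    also have "\<dots> = (\<Sum>i\<in>I. f i powr s) / F / s + (\<Sum>i\<in>I. g i powr r) / G / r"
      using f g uv by (simp add: sum.distrib sum_divide_distrib powr_divide us vr)
    also have "\<dots> = 1"
      using pos rs by (simp add: F_def[symmetric] G_def[symmetric])
    finally have "(\<Sum>i\<in>I. f i * g i) / (u * v) \<le> 1"
      by (simp add: sum_divide_distrib)
    then show ?thesis
      using uv by (simp add: u_def v_def F_def G_def divide_le_eq)
  qed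
qed

section \<open>Sharpness\<close>

text \<open>
  The scalar field as a normed space over itself, carried over to the image of an injection \<open>f\<close>
  into the vector type.
\<close>

definition scalar_copy :: "('k::real_normed_field \<Rightarrow> 'v) \<Rightarrow> ('k, 'v) module"
  where "scalar_copy f =
    \<lparr>carrier = range f,
     monoid.mult = (\<lambda>x y. f (inv_into UNIV f x * inv_into UNIV f y)), one = f 1,
     ring.zero = f 0, add = (\<lambda>x y. f (inv_into UNIV f x + inv_into UNIV f y)),
     module.smult = (\<lambda>c x. f (c * inv_into UNIV f x))\<rparr>"

lemma normed_space_scalar_copy:
  fixes f :: "'k::real_normed_field \<Rightarrow> 'v"
  assumes "inj f"
  shows "normed_space (scalar_copy f) (\<lambda>x. norm (inv_into UNIV f x))"
proof -
  note inv = inv_f_f[OF assms] inj_eq[OF assms]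
  have "abelian_group (scalar_copy f)"
  proof (rule abelian_groupI)
    fix x assume "x \<in> carrier (scalar_copy f)"
    then obtain c where "x = f c" by (auto simp: scalar_copy_def)
    then have "f (- c) \<oplus>\<^bsub>scalar_copy f\<^esub> x = \<zero>\<^bsub>scalar_copy f\<^esub>"
      by (simp add: scalar_copy_def inv)
    then show "\<exists>y\<in>carrier (scalar_copy f). y \<oplus>\<^bsub>scalar_copy f\<^esub> x = \<zero>\<^bsub>scalar_copy f\<^esub>"
      by (auto simp: scalar_copy_def)
  qed (auto simp: scalar_copy_def inv algebra_simps)
  then have "module (ring_of_type_algebra :: 'k ring) (scalar_copy f)"
    by (intro moduleI cring_from_type_algebra)
       (auto simp: scalar_copy_def ring_of_type_algebra_def inv algebra_simps)
  then show ?thesis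
    by (intro normed_space.intro normed_space_axioms.intro)
       (auto simp: scalar_copy_def inv norm_mult norm_triangle_ineq)
qed

lemma sharp_bound_if_attained:
  assumes "n \<ge> 2" and "normed_space V nrm" and "x \<in> {1..n} \<rightarrow> carrier V"
    and "nrm (chebyshev V n p a x) = R V nrm n p a x"
    and "R V nrm n p a x > 0"
  shows "sharp_bound R"
  unfolding sharp_bound_def
proof (intro allI impI)
  fix C :: real
  assume "\<forall>n\<ge>2. \<forall>V nrm p a x. normed_space V nrm \<longrightarrow> x \<in> {1..n} \<rightarrow> carrier V \<longrightarrow>
    nrm (chebyshev V n p a x) \<le> C * R V nrm n p a x"
  then have "R V nrm n p a x \<le> C * R V nrm n p a x"
    using assms by metis
  then show "C \<ge> 1" using assms(5) by simp
qed

text \<open>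
  With weights \<open>p = (1, 1)\<close>, scalars \<open>a = (0, 1)\<close> and vectors \<open>x = (0, 1)\<close> in the scalar field,
  both \<open>D\<^sub>1\<close> and \<open>\<Delta>x\<^sub>1\<close> are 1, which gives both sides of each of the three estimates the value 1.
\<close>

lemma exists_unit_example:
  assumes "lepoll (UNIV :: 'k::real_normed_field set) (UNIV :: 'v set)"
  obtains V :: "('k::real_normed_field, 'v) module" and nrm p a x where "normed_space V nrm"
    "x \<in> {1..2} \<rightarrow> carrier V" "nrm (chebyshev V 2 p a x) = 1"
    "norm (Ddet 2 p a 1) = 1" "nrm (fdiff V x 1) = 1"
proof -
  obtain f :: "'k \<Rightarrow> 'v" where f: "inj f" using assms unfolding lepoll_def by auto
  define V where "V = scalar_copy f"
  define nrm where "nrm = (\<lambda>x. norm (inv_into UNIV f x))"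
  define p :: "nat \<Rightarrow> real" where "p = (\<lambda>i. 1)"
  define a :: "nat \<Rightarrow> 'k" where "a = (\<lambda>i. if i = 2 then 1 else 0)"
  define x where "x = (\<lambda>i::nat. f (if i = 2 then 1 else 0))"
  interpret normed_space V nrm
    unfolding V_def nrm_def by (rule normed_space_scalar_copy[OF f])
  have x: "x \<in> {1..2} \<rightarrow> carrier V" by (auto simp: x_def V_def scalar_copy_def)
  have zero: "x 1 = \<zero>\<^bsub>V\<^esub>" and x2: "x 2 \<in> carrier V" and n2: "nrm (x 2) = 1"
    by (simp_all add: x_def V_def scalar_copy_def nrm_def inv_f_f[OF f])
  have d: "fdiff V x 1 = x 2"
    using x2 zero by (simp add: fdiff_def M.minus_eq numeral_2_eq_2)
  have "{1..2} = {1, 2::nat}" by auto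
  then have D: "Ddet 2 p a 1 = 1"
    by (simp add: Ddet_eq psum_def wsum_def p_def a_def)
  have "chebyshev V 2 p a x = Ddet 2 p a 1 \<odot>\<^bsub>V\<^esub> fdiff V x 1"
    using chebyshev_eq_sum_fdiff[OF _ x] x2
    by (simp add: d[simplified] smult_closed_UNIV)
  then have "nrm (chebyshev V 2 p a x) = 1"
    using x2 n2 by (simp add: D[simplified] d[simplified] nrm_smult)
  then show ?thesis
    using that[of V nrm x p a] normed_space_axioms x D d n2 by simp
qed

theorem theorem4:
  fixes V :: "('k::real_normed_field, 'v) module"
    and nrm :: "'v \<Rightarrow> real"
    and n :: nat
    and p :: "nat \<Rightarrow> real"
    and a :: "nat \<Rightarrow> 'k"
    and x :: "nat \<Rightarrow> 'v"
  assumes "n \<ge> 2"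
    and "normed_space V nrm"
    and "x \<in> {1..n} \<rightarrow> carrier V"
  shows "nrm (chebyshev V n p a x) \<le> bound_max_sum V nrm n p a x
    \<and> (\<forall>r s :: real. r > 1 \<longrightarrow> 1 / r + 1 / s = 1 \<longrightarrow>
        nrm (chebyshev V n p a x) \<le> bound_holder r s V nrm n p a x)
    \<and> nrm (chebyshev V n p a x) \<le> bound_sum_max V nrm n p a x
    \<and> (lepoll (UNIV :: 'k set) (UNIV :: 'v set) \<longrightarrow>
        sharp_bound (bound_max_sum :: ('k, 'v) module \<Rightarrow> _)
        \<and> (\<forall>r s :: real. r > 1 \<longrightarrow> 1 / r + 1 / s = 1 \<longrightarrow>
            sharp_bound (bound_holder r s :: ('k, 'v) module \<Rightarrow> _))
        \<and> sharp_bound (bound_sum_max :: ('k, 'v) module \<Rightarrow> _))"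
proof (intro conjI allI impI)
  interpret normed_space V nrm by fact
  let ?D = "\<lambda>i. norm (Ddet n p a i)" and ?d = "\<lambda>i. nrm (fdiff V x i)"
  have d: "0 \<le> ?d i" if "i \<in> {1..n-1}" for i
    using that by (intro nrm_nonneg fdiff_closed[OF assms(3)])
  have le: "nrm (chebyshev V n p a x) \<le> (\<Sum>i\<in>{1..n-1}. ?D i * ?d i)"
    using assms by (intro nrm_chebyshev_le) auto
  also have "\<dots> \<le> bound_max_sum V nrm n p a x"
    unfolding bound_max_sum_def by (intro sum_mult_le_Max_mult_sum d) auto
  finally show "nrm (chebyshev V n p a x) \<le> bound_max_sum V nrm n p a x" .
  show "nrm (chebyshev V n p a x) \<le> bound_holder r s V nrm n p a x"
    if "r > 1" "1 / r + 1 / s = 1" for r s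
  proof -
    note le
    also have "(\<Sum>i\<in>{1..n-1}. ?D i * ?d i) \<le> bound_holder r s V nrm n p a x"
      unfolding bound_holder_def using that by (intro Hoelder_inequality_sum d) auto
    finally show ?thesis .
  qed
  note le
  also have "(\<Sum>i\<in>{1..n-1}. ?D i * ?d i) = (\<Sum>i\<in>{1..n-1}. ?d i * ?D i)"
    by (simp only: mult.commute)
  also have "\<dots> \<le> (MAX i\<in>{1..n-1}. ?d i) * (\<Sum>i\<in>{1..n-1}. ?D i)"
    by (intro sum_mult_le_Max_mult_sum) auto
  finally show "nrm (chebyshev V n p a x) \<le> bound_sum_max V nrm n p a x"
    by (simp add: bound_sum_max_def mult.commute)
next
  assume "lepoll (UNIV :: 'k set) (UNIV :: 'v set)"
  then obtain W :: "('k, 'v) module" and nrm' p' a' x'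
    where ex: "normed_space W nrm'" "x' \<in> {1..2} \<rightarrow> carrier W"
      "nrm' (chebyshev W 2 p' a' x') = 1" "norm (Ddet 2 p' a' 1) = 1" "nrm' (fdiff W x' 1) = 1"
    by (rule exists_unit_example)
  note vals = ex(3) ex(4,5)[simplified]
  show "sharp_bound (bound_max_sum :: ('k, 'v) module \<Rightarrow> _)"
    by (rule sharp_bound_if_attained[OF _ ex(1,2), where p = p' and a = a'])
       (simp_all add: bound_max_sum_def vals)
  show "sharp_bound (bound_sum_max :: ('k, 'v) module \<Rightarrow> _)"
    by (rule sharp_bound_if_attained[OF _ ex(1,2), where p = p' and a = a'])
       (simp_all add: bound_sum_max_def vals)
  show "sharp_bound (bound_holder r s :: ('k, 'v) module \<Rightarrow> _)" for r s
    by (rule sharp_bound_if_attained[OF _ ex(1,2), where p = p' and a = a'])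
       (simp_all add: bound_holder_def vals)
qed

end
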